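(* If $\alpha$ and $\beta$ are distinct positive real numbers, then the signature sequences $S_\alpha$ and $S_\beta$ are distinct.
   Context: For a positive real number $\theta$, let $M_\theta$ be the multiset $\{i+j\theta : i,j\in\mathbb{N}\}$, where $\mathbb{N}$ is the set of positive integers. Arrange the elements of $M_\theta$ in nondecreasing order (listing repeated values, which occur exactly when $\theta$ is rational, with their multiplicity), so that the ordered multiset is written $(s_h+a_h\theta)_{h=1}^{\infty}$ with $s_h,a_h\in\mathbb{N}$. The sequence $S_\theta=(s_1,s_2,s_3,\ldots)$ is called the signature (sequence) of $\theta$. *)

theory Defs
  imports Complex_Main
begin

text \<open>
  The multiset of all \<open>i + j * \<theta>\<close> is indexed by the pairs \<open>(i, j)\<close> of positive integers.
  Arranging it in nondecreasing order with multiplicity means enumerating every pair exactly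
  once so that the values are nondecreasing. Sequences are indexed from \<open>0\<close>, so \<open>S h\<close> is the
  \<open>(h + 1)\<close>-th term of the signature.

  For rational \<open>\<theta>\<close> distinct pairs can have equal values, and no order among these is
  prescribed. Hence being a signature is a predicate, satisfied by the sequences arising
  from every way of ordering the ties.
\<close>

definition signature_arrangement :: "real \<Rightarrow> (nat \<Rightarrow> nat) \<Rightarrow> (nat \<Rightarrow> nat) \<Rightarrow> bool" where
  "signature_arrangement \<theta> s a \<longleftrightarrow>
     bij_betw (\<lambda>h. (s h, a h)) UNIV ({1..} \<times> {1..}) \<and>
     mono (\<lambda>h. real (s h) + real (a h) * \<theta>)"

definition is_signature :: "real \<Rightarrow> (nat \<Rightarrow> nat) \<Rightarrow> bool" where
  "is_signature \<theta> S \<longleftrightarrow> (\<exists>a. signature_arrangement \<theta> S a)"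

lemma is_signature_exists:
  assumes "\<theta> > 0"
  shows "\<exists>S. is_signature \<theta> S"
proof -
  define P :: "(nat \<times> nat) set" where "P = {1..} \<times> {1..}"
  define v where "v = (\<lambda>p :: nat \<times> nat. real (fst p) + real (snd p) * \<theta>)"
  define lt where "lt = (\<lambda>q p. v q < v p \<or> (v q = v p \<and> fst q < fst p))"
  define D where "D = (\<lambda>p. {q \<in> P. lt q p})"
  define r where "r = (\<lambda>p. card (D p))"
  have total: "lt p q \<or> lt q p" if "p \<noteq> q" for p q
  proof (rule ccontr)
    assume "\<not> (lt p q \<or> lt q p)"
    then have "v p = v q" "fst p = fst q" by (auto simp: lt_def)
    with assms have "snd p = snd q" by (simp add: v_def)
    with \<open>fst p = fst q\<close> that show False by (simp add: prod_eq_iff)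
  qed
  have fin: "finite (D p)" for p
  proof (rule finite_subset)
    show "D p \<subseteq> {..nat \<lceil>v p\<rceil>} \<times> {..nat \<lceil>v p / \<theta>\<rceil>}"
    proof
      fix q assume "q \<in> D p"
      then have le: "real (fst q) + real (snd q) * \<theta> \<le> v p"
        by (auto simp: D_def lt_def v_def)
      have "real (fst q) \<le> v p"
        using le assms by (smt (verit) mult_nonneg_nonneg of_nat_0_le_iff)
      moreover have "real (snd q) \<le> v p / \<theta>"
        using le assms by (simp add: pos_le_divide_eq)
      ultimately show "q \<in> {..nat \<lceil>v p\<rceil>} \<times> {..nat \<lceil>v p / \<theta>\<rceil>}"
        by (cases q) (auto, linarith+)
    qed
  qed simp
  have less: "r q < r p" if "lt q p" "q \<in> P" for p q
    unfolding r_def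
  proof (rule psubset_card_mono[OF fin])
    have "q \<in> D p" "q \<notin> D q" using that by (auto simp: D_def lt_def)
    moreover have "D q \<subseteq> D p" using that by (auto simp: D_def lt_def)
    ultimately show "D q \<subset> D p" by blast
  qed
  have inj: "inj_on r P"
    by (rule inj_onI) (metis less total less_irrefl)
  have seg: "r ` D p = {..<r p}" for p
  proof (rule card_subset_eq)
    show "r ` D p \<subseteq> {..<r p}" unfolding D_def using less by blast
    have "inj_on r (D p)" using inj by (rule inj_on_subset) (auto simp: D_def)
    then show "card (r ` D p) = card {..<r p}" by (simp add: card_image) (simp add: r_def)
  qed simp
  have "infinite P"
    by (simp add: P_def finite_cartesian_product_iff infinite_Ici)
  then have "infinite (r ` P)" using inj by (simp add: finite_image_iff)
  then have unb: "\<exists>p\<in>P. n < r p" for n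
    by (metis (no_types, lifting) finite_nat_set_iff_bounded_le imageE not_le)
  have "r ` P = UNIV"
  proof -
    have "n \<in> r ` P" for n
    proof -
      obtain p where "n < r p" using unb by blast
      then have "n \<in> r ` D p" by (simp add: seg)
      then show ?thesis by (auto simp: D_def)
    qed
    then show ?thesis by blast
  qed
  then have "bij_betw r P UNIV" using inj by (simp add: bij_betw_def)
  then have bij: "bij_betw (inv_into P r) UNIV P" by (rule bij_betw_inv_into)
  have "mono (\<lambda>h. v (inv_into P r h))"
  proof (rule monoI, rule ccontr)
    fix x y :: nat assume "x \<le> y" and neg: "\<not> v (inv_into P r x) \<le> v (inv_into P r y)"
    then have "lt (inv_into P r y) (inv_into P r x)" by (simp add: lt_def)
    moreover have "inv_into P r y \<in> P" using bij by (auto simp: bij_betw_def)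
    ultimately have "r (inv_into P r y) < r (inv_into P r x)" by (rule less)
    with \<open>x \<le> y\<close> \<open>r ` P = UNIV\<close> show False by (simp add: f_inv_into_f)
  qed
  with bij have "signature_arrangement \<theta> (fst \<circ> inv_into P r) (snd \<circ> inv_into P r)"
    by (simp add: signature_arrangement_def v_def P_def)
  then show ?thesis by (auto simp: is_signature_def)
qed

end

theory Submission
  imports Defs
begin

text \<open>
  The signature determines the whole arrangement: pairs with first coordinate \<open>i\<close> occur in order
  of their second coordinate, so \<open>a h\<close> counts the occurrences of \<open>s h\<close> up to index \<open>h\<close>. A rational
  \<open>p / q\<close> strictly between \<open>\<alpha>\<close> and \<open>\<beta>\<close> then yields the pairs \<open>(p + 1, 1)\<close> and \<open>(1, q + 1)\<close>, which
  are strictly ordered in opposite ways by the two numbers.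
\<close>

lemma signature_arrangement_snd_eq_card:
  assumes "\<theta> > 0" and arr: "signature_arrangement \<theta> s a"
  shows "a h = card {k. k \<le> h \<and> s k = s h}"
proof -
  from arr have bij: "bij_betw (\<lambda>h. (s h, a h)) UNIV ({1..} \<times> {1..})"
    and mono: "mono (\<lambda>h. real (s h) + real (a h) * \<theta>)"
    by (auto simp: signature_arrangement_def)
  have inj: "k = l" if "s k = s l" "a k = a l" for k l
    using that injD[OF bij_betw_imp_inj_on[OF bij], of k l] by simp
  have pos: "s k \<ge> 1" "a k \<ge> 1" for k
    using bij_betwE[OF bij, rule_format, of k] by simp_all
  have a_mono: "a k \<le> a l" if "k \<le> l" "s k = s l" for k l
    using monoD[OF mono \<open>k \<le> l\<close>] that \<open>\<theta> > 0\<close> by simp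
  \<comment> \<open>The second coordinates met so far alongside \<open>s h\<close> form an initial
    segment without gaps; as \<open>a\<close> is injective on these indices, counting them gives
    \<open>a h\<close>.\<close>
  have "a ` {k. k \<le> h \<and> s k = s h} = {1..a h}"
  proof (intro equalityI subsetI)
    fix j assume "j \<in> a ` {k. k \<le> h \<and> s k = s h}"
    then show "j \<in> {1..a h}" using a_mono pos by auto
  next
    fix j assume j: "j \<in> {1..a h}"
    from j pos have "(s h, j) \<in> range (\<lambda>h. (s h, a h))"
      using bij by (simp add: bij_betw_def)
    then obtain k where k: "s k = s h" "a k = j" by auto
    \<comment> \<open>If \<open>h < k\<close>, then \<open>a h \<le> a k = j \<le> a h\<close>, so
      the same pair would be listed at both indices.\<close>
    have "k \<le> h"
    proof (rule ccontr)
      assume "\<not> k \<le> h"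
      then have "a h \<le> a k" using a_mono[of h k] k by simp
      with j k have "k = h" using inj[of k h] by simp
      with \<open>\<not> k \<le> h\<close> show False by simp
    qed
    with k show "j \<in> a ` {k. k \<le> h \<and> s k = s h}" by auto
  qed
  moreover have "inj_on a {k. k \<le> h \<and> s k = s h}"
    by (rule inj_onI) (simp add: inj)
  ultimately show ?thesis
    by (metis card_image card_atLeastAtMost diff_Suc_1)
qed

lemma signature_arrangement_index_less:
  assumes "signature_arrangement \<theta> s a"
    and "real (s k) + real (a k) * \<theta> < real (s l) + real (a l) * \<theta>"
  shows "k < l"
proof (rule ccontr)
  assume "\<not> k < l"
  then have "real (s l) + real (a l) * \<theta> \<le> real (s k) + real (a k) * \<theta>"
    using assms(1) by (simp add: signature_arrangement_def mono_def)
  with assms(2) show False by simp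
qed

text \<open>With \<open>s\<close> and \<open>a\<close> shared, each pair has the same index for
  \<open>\<alpha>\<close> and \<open>\<beta>\<close>, so two pairs whose values compare in opposite
  ways would have contradictory index orders.\<close>

lemma not_signature_arrangement_both:
  assumes "\<alpha> > 0" "\<alpha> < \<beta>"
    and arr: "signature_arrangement \<alpha> s a" "signature_arrangement \<beta> s a"
  shows False
proof -
  obtain r where r: "r \<in> \<rat>" "\<alpha> < r" "r < \<beta>"
    using Rats_dense_in_real \<open>\<alpha> < \<beta>\<close> by blast
  with \<open>\<alpha> > 0\<close> obtain p q :: nat where pq: "q \<noteq> 0" "r = real p / real q"
    using Rats_abs_nat_div_natE[of r] by (metis abs_of_pos less_trans)
  have "\<alpha> * real q < real p" "real p < \<beta> * real q"
    using r pq by (simp_all add: field_simps)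
  moreover have range: "range (\<lambda>h. (s h, a h)) = {1..} \<times> {1..}"
    using arr by (simp add: signature_arrangement_def bij_betw_def)
  \<comment> \<open>The values of these pairs at \<theta> differ by \<open>p - q * \<theta>\<close>,
    which changes sign at \<open>r\<close>. Adding 1 keeps all coordinates positive, even without
    knowing \<open>p > 0\<close>.\<close>
  have "(p + 1, 1) \<in> range (\<lambda>h. (s h, a h))" "(1, q + 1) \<in> range (\<lambda>h. (s h, a h))"
    unfolding range by auto
  then obtain k l where "s k = p + 1" "a k = 1" "s l = 1" "a l = q + 1"
    by auto
  ultimately have "real (s l) + real (a l) * \<alpha> < real (s k) + real (a k) * \<alpha>"
    "real (s k) + real (a k) * \<beta> < real (s l) + real (a l) * \<beta>"
    by (simp_all add: algebra_simps)
  then have "l < k" "k < l"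
    using signature_arrangement_index_less arr by blast+
  then show False by simp
qed

theorem theorem8:
  fixes \<alpha> \<beta> :: real and S\<^sub>\<alpha> S\<^sub>\<beta> :: "nat \<Rightarrow> nat"
  assumes "\<alpha> > 0" and "\<beta> > 0" and "\<alpha> \<noteq> \<beta>"
    and "is_signature \<alpha> S\<^sub>\<alpha>" and "is_signature \<beta> S\<^sub>\<beta>"
  shows "S\<^sub>\<alpha> \<noteq> S\<^sub>\<beta>"
proof
  assume eq: "S\<^sub>\<alpha> = S\<^sub>\<beta>"
  obtain a b where a: "signature_arrangement \<alpha> S\<^sub>\<alpha> a" and b: "signature_arrangement \<beta> S\<^sub>\<alpha> b"
    using assms eq by (auto simp: is_signature_def)
  \<comment> \<open>Both are given by the same count, which involves only
    \<open>S\<^sub>\<alpha>\<close>.\<close>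
  have "a = b"
    using signature_arrangement_snd_eq_card[OF \<open>\<alpha> > 0\<close> a]
      signature_arrangement_snd_eq_card[OF \<open>\<beta> > 0\<close> b] by (simp add: fun_eq_iff)
  with a b assms(1-3) show False
    by (metis not_signature_arrangement_both linorder_neqE_linordered_idom)
qed

end
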